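(* Let $n$ and $k$ be positive integers with $k\le n/2$. As operators on the ring $\mathrm{Sym}(2k\,|\,n-2k)$, $$\nabla_k^D(n)=x_1\cdots x_{2k}\,\nabla_{2k}^B(n)+x_1\cdots x_{2k-1}\,\nabla_{2k-1}^B(n)\,\partial_1\partial_2\cdots\partial_{n-2k}.$$
   Context: $\mathrm{Sym}(2k\,|\,n-2k)$ is the subring of $\mathbb Z[\tfrac12][x_1,\ldots,x_n]$ of polynomials symmetric in $x_1,\ldots,x_{2k}$ and symmetric in $x_{2k+1},\ldots,x_n$. All operators act on what is written to their left, so products of operators are performed from left to right; polynomials used as operators act by multiplication (so $x_1\cdots x_m\nabla$ means: first multiply by $x_1\cdots x_m$, then apply $\nabla$). Simple divided differences: for $1\le i\le n-1$, $f\,\partial_i=\dfrac{f-f(\ldots,x_{i+1},x_i,\ldots)}{x_i-x_{i+1}}$ ($x_i$ and $x_{i+1}$ exchanged); $f\,\partial_0=\dfrac{f-f(-x_1,x_2,\ldots)}{-x_1}$; $f\,\partial_\heartsuit=\dfrac{f-f(-x_2,-x_1,x_3,\ldots)}{-x_1-x_2}$. For $k\le n$: $\nabla_k^B(n)=(\partial_0\partial_1\cdots\partial_{n-1})(\partial_0\partial_1\cdots\partial_{n-2})\cdots(\partial_0\partial_1\cdots\partial_{n-k})$, a product of $k$ factors. For $k\le n/2$: $\nabla_k^D(n)=(\partial_\heartsuit\partial_2\cdots\partial_{n-1}\,\partial_1\partial_2\cdots\partial_{n-2})(\partial_\heartsuit\partial_2\cdots\partial_{n-3}\,\partial_1\cdots\partial_{n-4})\cdots(\partial_\heartsuit\partial_2\cdots\partial_{n-2k+1}\,\partial_1\partial_2\cdots\partial_{n-2k})$,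 a product of $k$ factors (runs such as $\partial_2\cdots\partial_1$ or $\partial_1\cdots\partial_0$ are empty). *)

theory Defs
  imports Complex_Main "HOL-Library.Poly_Mapping" "HOL-Combinatorics.Permutations"
begin

text \<open>
  Polynomials in the variables \<open>xvar 0, xvar 1, \<dots>\<close> with rational coefficients; a monomial is its
  finitely supported exponent function. Only \<open>xvar 1, \<dots>, xvar n\<close> are used. The ring
  \<open>\<int>[1/2][x\<^sub>1, \<dots>, x\<^sub>n]\<close> is the subset \<open>dyadic_polys n\<close>.
\<close>

type_synonym qpoly = "(nat \<Rightarrow>\<^sub>0 nat) \<Rightarrow>\<^sub>0 rat"

definition xvar :: "nat \<Rightarrow> qpoly" where
  "xvar i = Poly_Mapping.single (Poly_Mapping.single i 1) 1"

definition dyadics :: "rat set" where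
  "dyadics = {c. \<exists>(a::int) (m::nat). c = of_int a / 2 ^ m}"

definition dyadic_polys :: "nat \<Rightarrow> qpoly set" where
  "dyadic_polys n = {f. (\<forall>m. Poly_Mapping.lookup f m \<in> dyadics) \<and>
                        (\<forall>m \<in> Poly_Mapping.keys f. Poly_Mapping.keys m \<subseteq> {1..n})}"

text \<open>\<open>psubst \<sigma> f\<close> is \<open>f\<close> with every \<open>xvar i\<close> replaced by \<open>\<sigma> i\<close>.\<close>

definition psubst :: "(nat \<Rightarrow> qpoly) \<Rightarrow> qpoly \<Rightarrow> qpoly" where
  "psubst \<sigma> f = (\<Sum>m \<in> Poly_Mapping.keys f.
     Poly_Mapping.single 0 (Poly_Mapping.lookup f m) *
     (\<Prod>i \<in> Poly_Mapping.keys m. \<sigma> i ^ Poly_Mapping.lookup m i))"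

definition symmetric_in :: "nat set \<Rightarrow> qpoly \<Rightarrow> bool" where
  "symmetric_in A f \<longleftrightarrow> (\<forall>\<pi>. \<pi> permutes A \<longrightarrow> psubst (\<lambda>i. xvar (\<pi> i)) f = f)"

text \<open>\<open>Sym(a | b)\<close>, inside the polynomials in \<open>a + b\<close> variables.\<close>

definition Sym :: "nat \<Rightarrow> nat \<Rightarrow> qpoly set" where
  "Sym a b = {f \<in> dyadic_polys (a + b). symmetric_in {1..a} f \<and> symmetric_in {a+1..a+b} f}"

text \<open>
  Exact division. It is only applied where the quotient exists (lemmas \<open>dd_Suc\<close>, \<open>dd_0\<close>,
  \<open>dd_heart\<close> below); the quotient is unique because the polynomial ring is a domain.
  The divisors are linear forms with leading coefficient \<open>1\<close> or \<open>-1\<close>, so quotients of polynomials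
  with coefficients in \<open>\<int>[1/2]\<close> have coefficients in \<open>\<int>[1/2]\<close> again.
\<close>

definition quot :: "qpoly \<Rightarrow> qpoly \<Rightarrow> qpoly" where
  "quot f d = (THE g. g * d = f)"

fun dd :: "nat \<Rightarrow> qpoly \<Rightarrow> qpoly" where
  "dd 0 f = quot (f - psubst (xvar(1 := - xvar 1)) f) (- xvar 1)"
| "dd (Suc i) f =
     quot (f - psubst (xvar(Suc i := xvar (Suc (Suc i)), Suc (Suc i) := xvar (Suc i))) f)
          (xvar (Suc i) - xvar (Suc (Suc i)))"

definition ddheart :: "qpoly \<Rightarrow> qpoly" where
  "ddheart f = quot (f - psubst (xvar(1 := - xvar 2, 2 := - xvar 1)) f) (- xvar 1 - xvar 2)"

text \<open>
  Operators act from the right, so a product \<open>A\<^sub>1 A\<^sub>2 \<cdots>\<close> applies \<open>A\<^sub>1\<close> first, as \<open>fold\<close> does.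
  \<open>ddrun a b\<close> is \<open>\<partial>\<^sub>a \<partial>\<^sub>a\<^sub>+\<^sub>1 \<cdots> \<partial>\<^sub>b\<close>, the identity if \<open>b < a\<close>.
\<close>

definition ddrun :: "nat \<Rightarrow> nat \<Rightarrow> qpoly \<Rightarrow> qpoly" where
  "ddrun a b = fold dd [a..<Suc b]"

text \<open>The parameter \<open>j\<close> numbers the factors of the products \<open>1, \<dots>, k\<close>.\<close>

definition nablaB :: "nat \<Rightarrow> nat \<Rightarrow> qpoly \<Rightarrow> qpoly" where
  "nablaB k n = fold (\<lambda>j. ddrun 0 (n - j)) [1..<Suc k]"

definition nablaD :: "nat \<Rightarrow> nat \<Rightarrow> qpoly \<Rightarrow> qpoly" where
  "nablaD k n =
     fold (\<lambda>j f. ddrun 1 (n - 2 * j) (ddrun 2 (n - 2 * j + 1) (ddheart f))) [1..<Suc k]"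


lemma sum_single_lookup:
  fixes p :: "'a \<Rightarrow>\<^sub>0 'b::comm_monoid_add"
  shows "(\<Sum>m \<in> Poly_Mapping.keys p. Poly_Mapping.single m (Poly_Mapping.lookup p m)) = p"
  by (rule poly_mapping_eqI) (simp add: lookup_sum lookup_single when_def in_keys_iff)

lemma single_eq_prod_xvar:
  "Poly_Mapping.single m c =
     Poly_Mapping.single 0 c * (\<Prod>i \<in> Poly_Mapping.keys m. xvar i ^ Poly_Mapping.lookup m i)"
proof -
  have pow: "xvar i ^ e = Poly_Mapping.single (Poly_Mapping.single i e) 1" for i e
    by (induction e) (simp_all add: xvar_def mult_single single_add [symmetric])
  have "(\<Prod>i \<in> A. xvar i ^ Poly_Mapping.lookup m i) =
      Poly_Mapping.single (\<Sum>i \<in> A. Poly_Mapping.single i (Poly_Mapping.lookup m i)) 1"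
    if "finite A" for A
    using that by (induction A rule: finite_induct) (simp_all add: pow mult_single)
  moreover have "(\<Sum>i \<in> Poly_Mapping.keys m. Poly_Mapping.single i (Poly_Mapping.lookup m i)) = m"
    by (rule sum_single_lookup)
  ultimately show ?thesis
    by (simp add: mult_single)
qed

lemma dvd_diff_psubst:
  assumes "\<And>i. d dvd xvar i - \<sigma> i"
  shows "d dvd f - psubst \<sigma> f"
proof -
  let ?P = "\<lambda>\<tau> m A. \<Prod>i \<in> A. (\<tau> i :: qpoly) ^ Poly_Mapping.lookup m i"
  have pow: "d dvd xvar i ^ e - \<sigma> i ^ e" for i e
    unfolding power_diff_sumr2 by (intro dvd_mult2 assms)
  have prd: "d dvd ?P xvar m A - ?P \<sigma> m A" if "finite A" for A and m :: "nat \<Rightarrow>\<^sub>0 nat"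
    using that
  proof (induction A rule: finite_induct)
    case (insert a A)
    let ?e = "Poly_Mapping.lookup m a"
    have "?P xvar m (insert a A) - ?P \<sigma> m (insert a A) =
        (xvar a ^ ?e - \<sigma> a ^ ?e) * ?P xvar m A + \<sigma> a ^ ?e * (?P xvar m A - ?P \<sigma> m A)"
      using insert.hyps by (simp add: algebra_simps)
    also have "d dvd \<dots>"
      by (intro dvd_add dvd_mult2 [OF pow] dvd_mult [OF insert.IH])
    finally show ?case .
  qed simp
  have "f = (\<Sum>m \<in> Poly_Mapping.keys f. Poly_Mapping.single m (Poly_Mapping.lookup f m))"
    by (rule sum_single_lookup [symmetric])
  also have "\<dots> = psubst xvar f"
    unfolding psubst_def by (rule sum.cong [OF refl single_eq_prod_xvar])
  finally have "f - psubst \<sigma> f = psubst xvar f - psubst \<sigma> f"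
    by simp
  also have "d dvd \<dots>"
    unfolding psubst_def sum_subtractf [symmetric] right_diff_distrib [symmetric]
    by (intro dvd_sum dvd_mult prd) simp
  finally show ?thesis .
qed

lemma quot_mult:
  assumes "d \<noteq> 0" "d dvd f"
  shows "quot f d * d = f"
proof -
  obtain g where g: "g * d = f"
    using assms(2) by (metis dvdE mult.commute)
  then have "quot f d = g"
    unfolding quot_def using assms(1) by (intro the_equality) auto
  then show ?thesis
    using g by simp
qed

lemma lookup_xvar: "Poly_Mapping.lookup (xvar i) (Poly_Mapping.single j 1) = (if i = j then 1 else 0)"
proof -
  have "Poly_Mapping.single i (1::nat) = Poly_Mapping.single j 1 \<longleftrightarrow> i = j"
    by (metis lookup_single_eq lookup_single_not_eq one_neq_zero)
  then show ?thesis
    by (simp add: xvar_def lookup_single when_def)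
qed

lemma xvar_inject: "xvar i = xvar j \<longleftrightarrow> i = j"
  by (metis lookup_xvar one_neq_zero)

lemma xvar_neq: "xvar i \<noteq> 0"
  by (metis lookup_xvar lookup_zero one_neq_zero)

lemma xvar_add_neq: "xvar i + xvar j \<noteq> 0"
proof
  assume "xvar i + xvar j = 0"
  then have "Poly_Mapping.lookup (xvar i + xvar j) (Poly_Mapping.single i 1) = 0"
    by simp
  then show False
    unfolding lookup_add lookup_xvar by (simp split: if_splits)
qed

lemma dd_0: "dd 0 f * (- xvar 1) = f - psubst (xvar(1 := - xvar 1)) f"
  unfolding dd.simps
proof (intro quot_mult dvd_diff_psubst)
  fix i show "- xvar 1 dvd xvar i - (xvar(1 := - xvar 1)) i"
    by (auto intro: dvd_add)
qed (simp add: xvar_neq)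

lemma dd_Suc:
  "dd (Suc i) f * (xvar (Suc i) - xvar (Suc (Suc i))) =
     f - psubst (xvar(Suc i := xvar (Suc (Suc i)), Suc (Suc i) := xvar (Suc i))) f"
  unfolding dd.simps
proof (intro quot_mult dvd_diff_psubst)
  fix j
  show "xvar (Suc i) - xvar (Suc (Suc i)) dvd
      xvar j - (xvar(Suc i := xvar (Suc (Suc i)), Suc (Suc i) := xvar (Suc i))) j"
    using dvd_minus_iff [of "xvar (Suc i) - xvar (Suc (Suc i))" "xvar (Suc i) - xvar (Suc (Suc i))"]
    by auto
qed (simp add: xvar_inject)

lemma dd_heart: "ddheart f * (- xvar 1 - xvar 2) = f - psubst (xvar(1 := - xvar 2, 2 := - xvar 1)) f"
  unfolding ddheart_def
proof (intro quot_mult dvd_diff_psubst)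
  have eq: "- xvar 1 - xvar 2 = - (xvar 1 + xvar 2)" by simp
  fix j show "- xvar 1 - xvar 2 dvd xvar j - (xvar(1 := - xvar 2, 2 := - xvar 1)) j"
    unfolding eq minus_dvd_iff by (auto simp: add.commute)
  show "- xvar 1 - xvar 2 \<noteq> 0"
    unfolding eq neg_equal_0_iff_equal by (rule xvar_add_neq)
qed

end

theory Submission imports Defs begin

text \<open>
  Moving commuting operators past each other factors a common operator (a longest Grassmannian word)
  out of all three terms and reduces the claim to \<open>n = 2k\<close>. There, let \<open>s\<close> be the sign change of
  \<open>x\<^sub>1\<close>, \<open>R\<^sub>m = \<partial>\<^sub>m\<^sub>-\<^sub>1 \<cdots> \<partial>\<^sub>1\<close>, and \<open>Q\<^sub>m = Q\<^sub>m\<^sub>-\<^sub>1 R\<^sub>m s\<close> with \<open>Q\<^sub>0 = f\<close>. Since \<open>\<partial>\<^sub>\<heartsuit> = s \<partial>\<^sub>1 s\<close>, the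
  type D operator sends \<open>f\<close> to \<open>Q\<^sub>2\<^sub>k\<close>. The braid relations and the symmetry of \<open>f\<close> show that
  \<open>Q\<^sub>m s R\<^sub>m\<^sub>+\<^sub>1 = 0\<close> and that \<open>Q\<^sub>m\<close> and \<open>Q\<^sub>m s\<close> are symmetric in \<open>x\<^sub>1, \<dots>, x\<^sub>m\<close>. The Leibniz rule then
  gives, by induction, \<open>x\<^sub>1 \<cdots> x\<^sub>m \<nabla>\<^sup>B\<^sub>m(m) = (-1)\<^sup>m (Q\<^sub>m + Q\<^sub>m s)\<close>, and one more \<open>R\<^sub>2\<^sub>k\<close> applied to the
  case \<open>m = 2k - 1\<close> gives \<open>- Q\<^sub>2\<^sub>k s\<close> for the second term.
\<close>

declare dd.simps [simp del]

section \<open>Substitution is a ring homomorphism\<close>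

lemma psubst_superset:
  assumes "finite S" "Poly_Mapping.keys f \<subseteq> S"
  shows "psubst \<sigma> f = (\<Sum>m\<in>S. Poly_Mapping.single 0 (Poly_Mapping.lookup f m) *
     (\<Prod>i \<in> Poly_Mapping.keys m. \<sigma> i ^ Poly_Mapping.lookup m i))"
  unfolding psubst_def using assms by (intro sum.mono_neutral_left) (auto simp: in_keys_iff)

lemma psubst_add: "psubst \<sigma> (f + g) = psubst \<sigma> f + psubst \<sigma> g"
proof -
  let ?S = "Poly_Mapping.keys f \<union> Poly_Mapping.keys g"
  have k: "Poly_Mapping.keys (f + g) \<subseteq> ?S" by (rule Poly_Mapping.keys_add)
  show ?thesis
    by (simp add: psubst_superset [OF _ k] psubst_superset [of ?S f] psubst_superset [of ?S g]
        lookup_add single_add distrib_right sum.distrib)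
qed

lemma psubst_zero [simp]: "psubst \<sigma> 0 = 0"
  by (simp add: psubst_def)

lemma psubst_uminus: "psubst \<sigma> (- f) = - psubst \<sigma> f"
  using psubst_add [of \<sigma> f "- f"] by (simp add: minus_unique)

lemma psubst_diff: "psubst \<sigma> (f - g) = psubst \<sigma> f - psubst \<sigma> g"
  using psubst_add [of \<sigma> f "- g"] by (simp add: psubst_uminus)

lemma psubst_sum: "psubst \<sigma> (sum f A) = (\<Sum>x\<in>A. psubst \<sigma> (f x))"
  by (induction A rule: infinite_finite_induct) (auto simp: psubst_add)

lemma psubst_single: "psubst \<sigma> (Poly_Mapping.single m c) =
   Poly_Mapping.single 0 c * (\<Prod>i \<in> Poly_Mapping.keys m. \<sigma> i ^ Poly_Mapping.lookup m i)"
  using psubst_superset [of "{m}" "Poly_Mapping.single m c" \<sigma>] by simp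

lemma psubst_const: "psubst \<sigma> (Poly_Mapping.single 0 c) = Poly_Mapping.single 0 c"
  by (simp add: psubst_single)

lemma psubst_xvar [simp]: "psubst \<sigma> (xvar i) = \<sigma> i"
  unfolding xvar_def psubst_single by simp

text \<open>Exponents add for single monomials; the general case follows by writing both factors as
  sums of monomials and distributing.\<close>

lemma psubst_mult: "psubst \<sigma> (f * g) = psubst \<sigma> f * psubst \<sigma> g"
proof -
  have mono: "(\<Prod>i \<in> Poly_Mapping.keys (a + b). \<sigma> i ^ Poly_Mapping.lookup (a + b) i) =
     (\<Prod>i \<in> Poly_Mapping.keys a. \<sigma> i ^ Poly_Mapping.lookup a i) *
     (\<Prod>i \<in> Poly_Mapping.keys b. \<sigma> i ^ Poly_Mapping.lookup b i)" for a b :: "nat \<Rightarrow>\<^sub>0 nat"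
  proof -
    let ?S = "Poly_Mapping.keys a \<union> Poly_Mapping.keys b"
    have ext: "(\<Prod>i \<in> Poly_Mapping.keys c. \<sigma> i ^ Poly_Mapping.lookup c i) =
        (\<Prod>i \<in> ?S. \<sigma> i ^ Poly_Mapping.lookup c i)" if "Poly_Mapping.keys c \<subseteq> ?S" for c
      using that by (intro prod.mono_neutral_left) (auto simp: in_keys_iff)
    show ?thesis
      unfolding ext [OF Poly_Mapping.keys_add] ext [OF Un_upper1] ext [OF Un_upper2]
      by (simp add: lookup_add power_add prod.distrib)
  qed
  let ?t = "\<lambda>f m. Poly_Mapping.single m (Poly_Mapping.lookup f m) :: qpoly"
  have "psubst \<sigma> (Poly_Mapping.single a c * Poly_Mapping.single b d) =
      psubst \<sigma> (Poly_Mapping.single a c) * psubst \<sigma> (Poly_Mapping.single b d)" for a b c d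
  proof -
    have "Poly_Mapping.single 0 (c * d) = Poly_Mapping.single 0 c * (Poly_Mapping.single 0 d :: qpoly)"
      by (simp add: mult_single)
    then show ?thesis
      by (simp only: mult_single [of a] psubst_single mono ac_simps)
  qed
  then have "psubst \<sigma> ((\<Sum>a \<in> Poly_Mapping.keys f. ?t f a) * (\<Sum>b \<in> Poly_Mapping.keys g. ?t g b)) =
      psubst \<sigma> (\<Sum>a \<in> Poly_Mapping.keys f. ?t f a) * psubst \<sigma> (\<Sum>b \<in> Poly_Mapping.keys g. ?t g b)"
    by (simp only: sum_product psubst_sum)
  then show ?thesis
    by (simp only: sum_single_lookup)
qed

lemma psubst_one [simp]: "psubst \<sigma> 1 = 1"
  using psubst_const [of \<sigma> 1] by simp

lemma psubst_power: "psubst \<sigma> (f ^ e) = psubst \<sigma> f ^ e"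
  by (induction e) (auto simp: psubst_mult)

lemma psubst_prod: "psubst \<sigma> (prod f A) = (\<Prod>x\<in>A. psubst \<sigma> (f x))"
  by (induction A rule: infinite_finite_induct) (auto simp: psubst_mult)

lemmas psubst_hom = psubst_add psubst_uminus psubst_diff psubst_mult

lemma psubst_psubst: "psubst \<sigma> (psubst \<tau> f) = psubst (\<lambda>i. psubst \<sigma> (\<tau> i)) f"
  by (simp add: psubst_def [of \<tau>] psubst_sum psubst_mult psubst_prod psubst_power psubst_const
      psubst_def [of "\<lambda>i. psubst \<sigma> (\<tau> i)"])

lemma psubst_ident [simp]: "psubst xvar f = f"
  unfolding psubst_def by (simp add: single_eq_prod_xvar [symmetric] sum_single_lookup)

section \<open>Reflections and simple roots of type B\<close>

fun rimg :: "nat \<Rightarrow> nat \<Rightarrow> qpoly" where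
  "rimg 0 = xvar(1 := - xvar 1)"
| "rimg (Suc i) = xvar(Suc i := xvar (Suc (Suc i)), Suc (Suc i) := xvar (Suc i))"

definition refl_act :: "nat \<Rightarrow> qpoly \<Rightarrow> qpoly" where
  "refl_act i = psubst (rimg i)"

text \<open>The divisors in \<open>dd\<close>, signed as there; with \<open>refl_act\<close> they
  merge both clauses of \<open>dd\<close> into the single formula \<open>dd_root\<close>.\<close>

fun simple_root :: "nat \<Rightarrow> qpoly" where
  "simple_root 0 = - xvar 1"
| "simple_root (Suc i) = xvar (Suc i) - xvar (Suc (Suc i))"

lemma root_neq_0: "simple_root i \<noteq> 0"
  by (cases i) (auto simp: xvar_neq xvar_inject)

lemma dd_root: "dd i f * simple_root i = f - refl_act i f"
  by (cases i) (simp_all only: dd_0 dd_Suc refl_act_def rimg.simps simple_root.simps)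

text \<open>The ring is a domain, so identities for \<open>dd\<close> may be checked after
  multiplying by the root. Most identities for \<open>dd\<close> below are proved by clearing
  denominators in this way.\<close>

lemma dd_eqI: "g * simple_root i = f - refl_act i f \<Longrightarrow> dd i f = g"
  by (metis dd_root mult_right_cancel root_neq_0)

lemmas refl_hom = psubst_hom [of "rimg i" for i, folded refl_act_def]

lemma refl_xvar_0: "refl_act 0 (xvar j) = (if j = 1 then - xvar 1 else xvar j)"
  by (simp add: refl_act_def)

lemma refl_xvar:
  "i > 0 \<Longrightarrow> refl_act i (xvar j) = 
     (if j = i then xvar (Suc i) else if j = Suc i then xvar i else xvar j)"
  by (cases i) (auto simp: refl_act_def)

text \<open>Composites are again substitutions, so relations between reflections need only be
  compared on variables.\<close>

lemma refl_refl: "refl_act i (refl_act j f) = psubst (\<lambda>l. refl_act i (rimg j l)) f"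
  by (simp add: refl_act_def psubst_psubst)

lemma refl_invol [simp]: "refl_act i (refl_act i f) = f"
proof -
  have "(\<lambda>l. refl_act i (rimg i l)) = xvar"
    by (cases i) (auto simp: refl_act_def psubst_uminus fun_eq_iff)
  then show ?thesis by (simp add: refl_refl)
qed

lemma refl_commute:
  assumes "Suc i < j"
  shows "refl_act i (refl_act j f) = refl_act j (refl_act i f)"
proof -
  obtain j' where j: "j = Suc j'" using assms by (cases j) auto
  have "(\<lambda>l. refl_act i (rimg j l)) = (\<lambda>l. refl_act j (rimg i l))"
    using assms unfolding j
    by (cases i) (auto simp: refl_act_def psubst_uminus fun_eq_iff)
  then show ?thesis by (simp add: refl_refl)
qed

lemma refl_braid:
  assumes "i > 0"
  shows "refl_act i (refl_act (Suc i) (refl_act i f)) =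
         refl_act (Suc i) (refl_act i (refl_act (Suc i) f))"
proof -
  obtain i' where i: "i = Suc i'" using assms by (cases i) auto
  show ?thesis
    unfolding refl_act_def psubst_psubst i
    by (rule arg_cong [where f = "\<lambda>\<sigma>. psubst \<sigma> f"]) (auto simp: fun_eq_iff)
qed

lemma refl_braid_B2:
  "refl_act 0 (refl_act 1 (refl_act 0 (refl_act 1 f))) =
   refl_act 1 (refl_act 0 (refl_act 1 (refl_act 0 f)))"
  unfolding refl_act_def psubst_psubst
  by (rule arg_cong [where f = "\<lambda>\<sigma>. psubst \<sigma> f"]) (auto simp: fun_eq_iff psubst_uminus)

lemma refl_root: "refl_act i (simple_root i) = - simple_root i"
  by (cases i) (simp_all add: refl_hom refl_xvar refl_xvar_0)

lemma refl_root_far: 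
  assumes "Suc i < j"
  shows "refl_act i (simple_root j) = simple_root j" and "refl_act j (simple_root i) = simple_root i"
  using assms by (cases j; cases i; simp add: refl_hom refl_xvar refl_xvar_0)+

section \<open>Relations between divided differences, and \<open>ddheart\<close>\<close>

lemma dd_add: "dd i (f + g) = dd i f + dd i g"
  by (rule dd_eqI) (simp add: distrib_right dd_root refl_hom)

lemma dd_zero [simp]: "dd i 0 = 0"
  by (rule dd_eqI) (simp add: refl_act_def)

lemma dd_uminus: "dd i (- f) = - dd i f"
  by (rule dd_eqI) (simp add: dd_root refl_hom)

lemma dd_eq_0_iff: "dd i f = 0 \<longleftrightarrow> refl_act i f = f"
  by (metis dd_root dd_eqI eq_iff_diff_eq_0 mult_zero_left)

lemma dd_mult_invariant: "refl_act i g = g \<Longrightarrow> dd i (g * f) = g * dd i f"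
  by (rule dd_eqI) (simp add: mult.assoc dd_root refl_hom right_diff_distrib)

text \<open>Numerator and root both change sign under the reflection, so the quotient is
  fixed.\<close>

lemma refl_dd: "refl_act i (dd i f) = dd i f"
proof -
  have "refl_act i (dd i f * simple_root i) = refl_act i f - f"
    by (simp add: dd_root refl_hom)
  then have "refl_act i (dd i f) * simple_root i = - (refl_act i f - f)"
    by (simp only: refl_hom refl_root mult_minus_right) (metis minus_minus)
  then have "refl_act i (dd i f) * simple_root i = dd i f * simple_root i"
    by (simp add: dd_root)
  then show ?thesis using root_neq_0 by simp
qed

lemma dd_dd [simp]: "dd i (dd i f) = 0"
  by (simp add: dd_eq_0_iff refl_dd)

lemma refl_dd_far:
  assumes "Suc i < j"
  shows "refl_act i (dd j f) = dd j (refl_act i f)"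
proof -
  have "refl_act i (dd j f) * simple_root j = refl_act i (dd j f * simple_root j)"
    by (simp add: refl_hom refl_root_far assms)
  then show ?thesis
    by (intro dd_eqI [symmetric]) (simp add: dd_root refl_hom refl_commute [OF assms])
qed

text \<open>The root of \<open>i\<close> is fixed by the reflection \<open>j\<close>, so
  \<open>dd j\<close> passes through the division by it.\<close>

lemma dd_commute:
  assumes "Suc i < j"
  shows "dd i (dd j f) = dd j (dd i f)"
proof (rule dd_eqI)
  have "dd j (dd i f) * simple_root i = simple_root i * dd j (dd i f)" by (rule mult.commute)
  also have "\<dots> = dd j (dd i f * simple_root i)"
    by (simp add: dd_mult_invariant [symmetric] refl_root_far assms mult.commute)
  also have "\<dots> = dd j f + dd j (- refl_act i f)"
    by (simp add: dd_root dd_add [symmetric])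
  also have "\<dots> = dd j f - refl_act i (dd j f)"
    by (simp add: refl_dd_far assms dd_uminus)
  finally show "dd j (dd i f) * simple_root i = dd j f - refl_act i (dd j f)" .
qed

text \<open>The alternating sum over the six elements of the symmetric group on three letters,
  divided by the product of the three positive roots. Stating it for \<open>p\<close> and
  \<open>q\<close> covers both sides of the braid relation; they differ only in the last term, where
  \<open>refl_braid\<close> applies.\<close>

lemma dd_dd_dd:
  fixes f :: qpoly
  assumes "i > 0" "{i, Suc i} = {p, q}" "p \<noteq> q"
  shows "dd p (dd q (dd p f)) * (simple_root i * simple_root (Suc i) * (simple_root i + simple_root (Suc i))) =
    f - refl_act p f - refl_act q f + refl_act q (refl_act p f) + refl_act p (refl_act q f)
      - refl_act p (refl_act q (refl_act p f))"
proof -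
  define g h where "g = dd p f" and "h = dd q g"
  let ?r = "simple_root p + simple_root q"
  have pq: "p = i \<and> q = Suc i \<or> p = Suc i \<and> q = i" using assms by auto
  obtain i' where i': "i = Suc i'" using assms by (cases i) auto
  \<comment> \<open>\<open>?r\<close> is the third positive root; each reflection interchanges it
    with the other simple root.\<close>
  have r: "refl_act p (simple_root q) = ?r" "refl_act q (simple_root p) = ?r" "refl_act p ?r = simple_root q"
    using pq by (auto simp: i' refl_hom refl_xvar)
  have 1: "dd p h * simple_root p = h - refl_act p h" by (rule dd_root)
  have 2: "h * simple_root q = g - refl_act q g" unfolding h_def by (rule dd_root)
  have 3: "g * simple_root p = f - refl_act p f" unfolding g_def by (rule dd_root)
  have 4: "refl_act p g = g" unfolding g_def by (rule refl_dd)
  have 5: "refl_act p h * ?r = g - refl_act p (refl_act q g)"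
    using arg_cong [OF 2, of "refl_act p"] by (simp only: refl_hom r 4)
  have 6: "refl_act q g * ?r = refl_act q f - refl_act q (refl_act p f)"
    using arg_cong [OF 3, of "refl_act q"] by (simp only: refl_hom r)
  have 7: "refl_act p (refl_act q g) * simple_root q = 
      refl_act p (refl_act q f) - refl_act p (refl_act q (refl_act p f))"
    using arg_cong [OF 6, of "refl_act p"] by (simp only: refl_hom(3,4) r(3))
  have "dd p h * (simple_root p * simple_root q * ?r) = dd p h * simple_root p * simple_root q * ?r"
    by (simp only: mult.assoc)
  also have "\<dots> = h * simple_root q * ?r - refl_act p h * ?r * simple_root q"
    unfolding 1 by (simp add: algebra_simps)
  also have "\<dots> = (g - refl_act q g) * ?r - (g - refl_act p (refl_act q g)) * simple_root q"
    by (simp only: 2 5)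
  also have "\<dots> = g * simple_root p - refl_act q g * ?r + refl_act p (refl_act q g) * simple_root q"
    by (simp add: algebra_simps)
  also have "\<dots> = f - refl_act p f - refl_act q f + refl_act q (refl_act p f) + refl_act p (refl_act q f)
      - refl_act p (refl_act q (refl_act p f))"
    unfolding 3 6 7 by simp
  finally show ?thesis
    using pq by (auto simp: h_def g_def mult.commute add.commute)
qed

lemma dd_braid:
  assumes "i > 0"
  shows "dd i (dd (Suc i) (dd i f)) = dd (Suc i) (dd i (dd (Suc i) f))"
proof -
  have n: "simple_root i * simple_root (Suc i) * (simple_root i + simple_root (Suc i)) \<noteq> 0"
    using assms by (cases i) (auto simp: xvar_inject)
  have "dd i (dd (Suc i) (dd i f)) * (simple_root i * simple_root (Suc i) * (simple_root i + simple_root (Suc i))) =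
        dd (Suc i) (dd i (dd (Suc i) f)) * (simple_root i * simple_root (Suc i) * (simple_root i + simple_root (Suc i)))"
    unfolding dd_dd_dd [OF assms refl n_not_Suc_n] dd_dd_dd [OF assms insert_commute Suc_n_not_n]
    by (simp add: refl_braid [OF assms])
  with n show ?thesis by (metis mult_right_cancel)
qed

text \<open>The sign change of x_1 carries the root x_1 - x_2 to -x_1 - x_2, the divisor in
  \<open>ddheart\<close>.\<close>

lemma ddheart_eq: "ddheart f = refl_act 0 (dd 1 (refl_act 0 f))"
proof -
  have n: "- xvar 1 - xvar 2 \<noteq> 0"
    using xvar_add_neq [of 1 2] by (metis add_uminus_conv_diff minus_add_distrib neg_equal_0_iff_equal)
  have *: "refl_act 0 (refl_act 1 (refl_act 0 f)) = psubst (xvar(1 := - xvar 2, 2 := - xvar 1)) f"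
    unfolding refl_act_def psubst_psubst
    by (rule arg_cong [where f = "\<lambda>\<sigma>. psubst \<sigma> f"])
      (auto simp: fun_eq_iff psubst_uminus numeral_2_eq_2)
  have "refl_act 0 (dd 1 (refl_act 0 f) * simple_root 1) = 
      refl_act 0 (refl_act 0 f - refl_act 1 (refl_act 0 f))"
    by (simp only: dd_root)
  then have "refl_act 0 (dd 1 (refl_act 0 f)) * (- xvar 1 - xvar 2) = ddheart f * (- xvar 1 - xvar 2)"
    unfolding dd_heart * [symmetric] by (simp add: refl_hom refl_xvar_0 numeral_2_eq_2)
  then show ?thesis
    using n by (metis mult_right_cancel)
qed

text \<open>The two roots are orthogonal: each is fixed by the reflection of the other, and the
  reflections commute by \<open>refl_braid_B2\<close>.\<close>

lemma ddheart_dd_1_commute: "ddheart (dd 1 f) = dd 1 (ddheart f)"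
proof -
  let ?s = "refl_act 0" and ?t = "refl_act 1" and ?h = "- xvar 1 - xvar 2"
  have h: "ddheart g * ?h = g - ?s (?t (?s g))" for g
    unfolding dd_heart refl_act_def psubst_psubst
    by (rule arg_cong [where f = "\<lambda>\<sigma>. g - psubst \<sigma> g"])
      (auto simp: fun_eq_iff psubst_uminus numeral_2_eq_2)
  have inv: "?t ?h = ?h" "?s (?t (?s (simple_root 1))) = simple_root 1"
    by (simp_all add: refl_hom refl_xvar refl_xvar_0 numeral_2_eq_2)
  have n: "?h \<noteq> 0"
    using xvar_add_neq [of 1 2] by (metis add_uminus_conv_diff minus_add_distrib neg_equal_0_iff_equal)
  have "(ddheart (dd 1 f) * simple_root 1) * ?h = (dd 1 f - ?s (?t (?s (dd 1 f)))) * simple_root 1"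
    by (simp only: h [symmetric] ac_simps)
  also have "\<dots> = dd 1 f * simple_root 1 - ?s (?t (?s (dd 1 f * simple_root 1)))"
    by (simp only: refl_hom inv left_diff_distrib)
  also have "\<dots> = f - ?t f - ?s (?t (?s f)) + ?s (?t (?s (?t f)))"
    by (simp only: dd_root refl_hom) simp
  also have "\<dots> = ddheart f * ?h - ?t (ddheart f * ?h)"
    unfolding h by (simp only: refl_hom refl_braid_B2) simp
  also have "\<dots> = (ddheart f - ?t (ddheart f)) * ?h"
    by (simp only: refl_hom(4) inv left_diff_distrib)
  finally show ?thesis
    using n by (intro dd_eqI [symmetric]) (metis mult_right_cancel)
qed

section \<open>Words in the divided differences\<close>

lemma fold_dd_zero [simp]: "fold dd xs 0 = 0"
  by (induction xs) auto

lemma fold_dd_add: "fold dd xs (f + g) = fold dd xs f + fold dd xs g"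
  by (induction xs arbitrary: f g) (auto simp: dd_add)

lemma fold_dd_mult_invariant:
  "(\<And>i. i \<in> set xs \<Longrightarrow> refl_act i g = g) \<Longrightarrow> fold dd xs (g * f) = g * fold dd xs f"
  by (induction xs arbitrary: f) (auto simp: dd_mult_invariant)

lemma dd_fold_dd:
  "(\<And>j. j \<in> set ys \<Longrightarrow> Suc i < j) \<Longrightarrow> dd i (fold dd ys f) = fold dd ys (dd i f)"
  by (induction ys arbitrary: f) (auto simp: dd_commute)

lemma dd_fold_dd':
  "(\<And>j. j \<in> set ys \<Longrightarrow> Suc j < i) \<Longrightarrow> dd i (fold dd ys f) = fold dd ys (dd i f)"
  by (induction ys arbitrary: f) (auto simp: dd_commute [symmetric])

lemma fold_dd_commute:
  assumes "\<And>i j. i \<in> set xs \<Longrightarrow> j \<in> set ys \<Longrightarrow> Suc i < j"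
  shows "fold dd xs (fold dd ys f) = fold dd ys (fold dd xs f)"
  using assms by (induction xs arbitrary: f) (auto simp: dd_fold_dd)

lemma refl_fold_dd:
  "(\<And>j. j \<in> set ys \<Longrightarrow> Suc i < j) \<Longrightarrow> refl_act i (fold dd ys f) = fold dd ys (refl_act i f)"
  by (induction ys arbitrary: f) (auto simp: refl_dd_far)

text \<open>Letters above 2 are far from both 0 and 1, the indices from which \<open>ddheart\<close>
  is built.\<close>

lemma ddheart_fold_dd:
  "(\<And>j. j \<in> set ys \<Longrightarrow> 2 < j) \<Longrightarrow> ddheart (fold dd ys f) = fold dd ys (ddheart f)"
  unfolding ddheart_eq
  by (simp add: refl_fold_dd dd_fold_dd Suc_lessD numeral_2_eq_2)

section \<open>Splitting off the Grassmannian word\<close>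

text \<open>
  For \<open>r = k\<close> this is the reduced word \<open>(k \<dots> n-1)(k-1 \<dots> n-2) \<cdots> (1 \<dots> n-k)\<close> of the longest
  Grassmannian permutation; splitting it off reduces \<open>n\<close> to \<open>k\<close>.
\<close>

definition grass_word :: "nat \<Rightarrow> nat \<Rightarrow> nat \<Rightarrow> nat list" where
  "grass_word k r n = concat (map (\<lambda>j. [Suc k - j..<Suc (n - j)]) [1..<Suc r])"

lemma grass_word_0 [simp]: "grass_word k 0 n = []"
  by (simp add: grass_word_def)

lemma grass_word_Suc: "grass_word k (Suc r) n = grass_word k r n @ [k - r..<Suc (n - Suc r)]"
  by (simp add: grass_word_def)

text \<open>Strictness leaves a gap: letters below \<open>k - r\<close> are at distance at least 2
  from the word and commute with it.\<close>

lemma set_grass_word: "i \<in> set (grass_word k r n) \<Longrightarrow> k - r < i" if "r \<le> k"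
  using that by (auto simp: grass_word_def)

lemma nablaB_0 [simp]: "nablaB 0 n f = f"
  by (simp add: nablaB_def)

lemma nablaB_Suc: "nablaB (Suc r) n f = ddrun 0 (n - Suc r) (nablaB r n f)"
  by (simp add: nablaB_def)

lemma nablaD_0 [simp]: "nablaD 0 n f = f"
  by (simp add: nablaD_def)

lemma nablaD_Suc: "nablaD (Suc r) n f =
    ddrun 1 (n - 2 * Suc r) (ddrun 2 (n - 2 * Suc r + 1) (ddheart (nablaD r n f)))"
  by (simp add: nablaD_def)

lemma fold_dd_upt_split:
  assumes "a \<le> b" "b \<le> c"
  shows "fold dd [a..<c] f = fold dd [b..<c] (fold dd [a..<b] f)"
  using upt_add_eq_append [OF assms(1), of "c - b"] assms by simp

text \<open>Cut the next factor at \<open>k - r\<close>. Its lower part is the factor for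
  \<open>k\<close> variables and moves back past the word; its upper part is the next segment of the
  word.\<close>

lemma nablaB_split:
  assumes "r \<le> k" "k \<le> n"
  shows "nablaB r n f = fold dd (grass_word k r n) (nablaB r k f)"
  using assms(1)
proof (induction r)
  case (Suc r)
  let ?G = "fold dd (grass_word k r n)"
  have "nablaB (Suc r) n f = fold dd [0..<n - r] (?G (nablaB r k f))"
    using Suc assms by (simp add: nablaB_Suc ddrun_def Suc_diff_Suc del: upt_Suc)
  also have "\<dots> = fold dd [k - r..<n - r] (fold dd [0..<k - r] (?G (nablaB r k f)))"
    using assms by (intro fold_dd_upt_split) auto
  also have "fold dd [0..<k - r] (?G (nablaB r k f)) = ?G (fold dd [0..<k - r] (nablaB r k f))"
    using Suc.prems set_grass_word [of r k _ n] by (intro fold_dd_commute) fastforce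
  finally show ?case
    using Suc.prems assms
    by (simp add: nablaB_Suc ddrun_def grass_word_Suc Suc_diff_Suc del: upt_Suc)
qed simp

text \<open>As in type B, but each factor has two runs, cut at \<open>a\<close> and
  \<open>a - 1\<close>. Their upper parts are two consecutive segments of the word.\<close>

lemma nablaD_split:
  assumes "r \<le> k" "2 * k \<le> n"
  shows "nablaD r n f = fold dd (grass_word (2 * k) (2 * r) n) (nablaD r (2 * k) f)"
  using assms(1)
proof (induction r)
  case (Suc r)
  let ?G = "fold dd (grass_word (2 * k) (2 * r) n)"
  define a b where "a = 2 * k - 2 * r" and "b = n - 2 * r"
  have ab: "2 \<le> a" "a \<le> b" using Suc.prems assms by (auto simp: a_def b_def)
  have G: "j \<in> set (grass_word (2 * k) (2 * r) n) \<Longrightarrow> a < j" for j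
    using set_grass_word [of "2 * r" "2 * k" j n] Suc.prems by (simp add: a_def)
  let ?X = "nablaD r (2 * k) f"
  have "nablaD (Suc r) n f = fold dd [1..<b - 1] (fold dd [2..<b] (ddheart (?G ?X)))"
    using Suc ab by (simp add: nablaD_Suc ddrun_def Suc_diff_Suc a_def b_def del: upt_Suc)
  also have "ddheart (?G ?X) = ?G (ddheart ?X)"
    using G ab by (intro ddheart_fold_dd) fastforce
  also have "fold dd [2..<b] (?G (ddheart ?X)) = fold dd [a..<b] (fold dd [2..<a] (?G (ddheart ?X)))"
    using ab by (intro fold_dd_upt_split) auto
  also have "fold dd [2..<a] (?G (ddheart ?X)) = ?G (fold dd [2..<a] (ddheart ?X))"
    using G by (intro fold_dd_commute) fastforce
  also have "fold dd [1..<b - 1] (fold dd [a..<b] (?G (fold dd [2..<a] (ddheart ?X)))) =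
      fold dd [a - 1..<b - 1] (fold dd [1..<a - 1]
        (fold dd [a..<b] (?G (fold dd [2..<a] (ddheart ?X)))))"
    using ab by (intro fold_dd_upt_split) auto
  \<comment> \<open>Letters at most \<open>a - 2\<close> meet letters at least \<open>a\<close>, so
    the lower part of the second run passes the upper part of the first.\<close>
  also have "fold dd [1..<a - 1] (fold dd [a..<b] (?G (fold dd [2..<a] (ddheart ?X)))) =
      fold dd [a..<b] (fold dd [1..<a - 1] (?G (fold dd [2..<a] (ddheart ?X))))"
    by (intro fold_dd_commute) auto
  also have "fold dd [1..<a - 1] (?G (fold dd [2..<a] (ddheart ?X))) =
      ?G (fold dd [1..<a - 1] (fold dd [2..<a] (ddheart ?X)))"
    using G by (intro fold_dd_commute) fastforce
  also have "fold dd [1..<a - 1] (fold dd [2..<a] (ddheart ?X)) = nablaD (Suc r) (2 * k) f"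
    using ab by (simp add: nablaD_Suc ddrun_def Suc_diff_Suc a_def del: upt_Suc)
  finally show ?case
    using ab by (simp add: grass_word_Suc a_def b_def Suc_diff_Suc del: upt_Suc)
qed simp

section \<open>Descending runs\<close>

text \<open>This is \<open>R\<^sub>m\<close> of the overview.\<close>

definition ddown :: "nat \<Rightarrow> qpoly \<Rightarrow> qpoly" where
  "ddown m = fold dd (rev [1..<m])"

lemma ddown_zero [simp]: "ddown m 0 = 0"
  by (simp add: ddown_def)

lemma ddown_1 [simp]: "ddown (Suc 0) f = f"
  by (simp add: ddown_def)

lemma ddown_Suc: "m > 0 \<Longrightarrow> ddown (Suc m) f = ddown m (dd m f)"
  by (simp add: ddown_def)

lemma rev_upt_Cons: "a < b \<Longrightarrow> rev [a..<b] = rev [Suc a..<b] @ [a]"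
  by (simp add: upt_conv_Cons)

text \<open>Isolates the last letter 1, the only one in the run that does not commute with
  \<open>refl_act 0\<close>.\<close>

lemma ddown_last: "m > 0 \<Longrightarrow> ddown (Suc m) f = dd 1 (fold dd (rev [2..<Suc m]) f)"
  by (simp add: ddown_def rev_upt_Cons numeral_2_eq_2 del: upt_Suc)

text \<open>With one extra variable every segment is a single letter.\<close>

lemma grass_word_single: "r \<le> k \<Longrightarrow> grass_word k r (Suc k) = rev [Suc k - r..<Suc k]"
proof (induction r)
  case (Suc r)
  then show ?case
    by (simp add: grass_word_Suc rev_upt_Cons [of "k - r"] Suc_diff_le del: upt_Suc)
      (simp add: Suc_diff_Suc upt_rec)
qed simp

lemma nablaB_Suc_diag: "nablaB m (Suc m) f = ddown (Suc m) (nablaB m m f)"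
  using nablaB_split [of m m "Suc m" f] by (simp add: grass_word_single ddown_def del: upt_Suc)

text \<open>With two extra variables every segment is a pair \<open>a, Suc a\<close>. Sorting the
  lower letters to the front gives two descending runs, since \<open>a\<close> passes all letters
  from \<open>a + 2\<close> on.\<close>

lemma fold_grass_word_double: "r \<le> k \<Longrightarrow> fold dd (grass_word k r (Suc (Suc k))) f =
    fold dd (rev [Suc (Suc k) - r..<Suc (Suc k)]) (fold dd (rev [Suc k - r..<Suc k]) f)"
proof (induction r)
  case (Suc r)
  define a where "a = k - r"
  have a: "Suc k - r = Suc a" "Suc (Suc k) - r = Suc (Suc a)" "a \<le> k"
    "Suc (Suc k) - Suc r = Suc a" "Suc k - Suc r = a"
    using Suc.prems by (auto simp: a_def)
  have upt: "[a..<Suc (Suc a)] = [a, Suc a]"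
    by (simp add: upt_conv_Cons)
  have "fold dd (grass_word k (Suc r) (Suc (Suc k))) f =
      dd (Suc a) (dd a (fold dd (rev [Suc (Suc a)..<Suc (Suc k)]) (fold dd (rev [Suc a..<Suc k]) f)))"
    using Suc a upt
    unfolding grass_word_Suc by (simp add: a_def [symmetric] del: upt_Suc)
  also have "dd a (fold dd (rev [Suc (Suc a)..<Suc (Suc k)]) (fold dd (rev [Suc a..<Suc k]) f)) =
      fold dd (rev [Suc (Suc a)..<Suc (Suc k)]) (dd a (fold dd (rev [Suc a..<Suc k]) f))"
    by (intro dd_fold_dd) auto
  finally show ?case
    using a by (simp add: rev_upt_Cons [of a] rev_upt_Cons [of "Suc a" "Suc (Suc k)"] del: upt_Suc)
qed simp

section \<open>Type D with \<open>n = 2 * k\<close>, and symmetry of \<open>flip_sym\<close>\<close>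

text \<open>
  For \<open>f\<close> symmetric in \<open>x\<^sub>1, \<dots>, x\<^sub>m\<close>, up to sign, \<open>flip_sym m f\<close> is the sum of \<open>f(\<plusminus>x\<^sub>1, \<dots>, \<plusminus>x\<^sub>m) / \<Prod>\<^sub>i\<^sub><\<^sub>j (\<plusminus>x\<^sub>i \<plusminus> x\<^sub>j)\<close> over the
  sign vectors with \<open>m\<close> minus signs modulo \<open>2\<close>, and applying \<open>refl_act 0\<close> changes the parity.
\<close>

primrec flip_sym :: "nat \<Rightarrow> qpoly \<Rightarrow> qpoly" where
  "flip_sym 0 f = f"
| "flip_sym (Suc m) f = refl_act 0 (ddown (Suc m) (flip_sym m f))"

lemma refl_0_flip_sym: "refl_act 0 (flip_sym (Suc m) f) = ddown (Suc m) (flip_sym m f)"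
  by simp

text \<open>Two more variables contribute two descending runs and a final \<open>ddheart\<close>,
  which together make two steps of \<open>flip_sym\<close>.\<close>

lemma nablaD_diag: "nablaD k (2 * k) f = flip_sym (2 * k) f"
proof (induction k)
  case (Suc k)
  let ?g = "ddown (Suc (2 * k)) (flip_sym (2 * k) f)"
  \<comment> \<open>In the last factor both runs are empty.\<close>
  have "nablaD (Suc k) (2 * Suc k) f = ddheart (nablaD k (Suc (Suc (2 * k))) f)"
    by (simp add: nablaD_Suc ddrun_def)
  also have "nablaD k (Suc (Suc (2 * k))) f =
      fold dd (grass_word (2 * k) (2 * k) (Suc (Suc (2 * k)))) (flip_sym (2 * k) f)"
    using nablaD_split [of k k "Suc (Suc (2 * k))" f] Suc by simp
  also have "\<dots> = fold dd (rev [2..<Suc (Suc (2 * k))]) ?g"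
    by (simp add: fold_grass_word_double ddown_def numeral_2_eq_2 del: upt_Suc)
  \<comment> \<open>The inner \<open>refl_act 0\<close> passes the letters from 2 on; the remaining
    \<open>dd 1\<close> then completes the longer run.\<close>
  also have "ddheart \<dots> = refl_act 0 (dd 1 (fold dd (rev [2..<Suc (Suc (2 * k))]) (refl_act 0 ?g)))"
    unfolding ddheart_eq by (subst refl_fold_dd) auto
  also have "\<dots> = flip_sym (2 * Suc k) f"
    by (simp add: ddown_last [of "Suc (2 * k)"] del: upt_Suc)
  finally show ?case .
qed simp

text \<open>Induction on \<open>m\<close>: the top letter of the second run moves inward to the
  argument, and the braid relation shows that the new argument is again killed by the letter one
  lower.\<close>

lemma ddown_ddown_eq_0: "m > 0 \<Longrightarrow> dd m g = 0 \<Longrightarrow> ddown (Suc m) (ddown m g) = 0"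
proof (induction m arbitrary: g)
  case (Suc m)
  show ?case
  proof (cases "m = 0")
    case True
    then show ?thesis using Suc.prems by (simp add: ddown_Suc)
  next
    case False
    then have "ddown (Suc (Suc m)) (ddown (Suc m) g) = 
        ddown (Suc m) (dd (Suc m) (ddown m (dd m g)))"
      by (simp add: ddown_Suc)
    also have "dd (Suc m) (ddown m (dd m g)) = ddown m (dd (Suc m) (dd m g))"
      unfolding ddown_def by (intro dd_fold_dd') auto
    also have "ddown (Suc m) \<dots> = 0"
      using False Suc.prems by (intro Suc.IH) (simp_all add: dd_braid)
    finally show ?thesis .
  qed
qed simp

text \<open>The run acts like a cycle and shifts indices by one; the braid relation is used where
  the run contains \<open>Suc i\<close> and \<open>i\<close> on top.\<close>

lemma dd_Suc_ddown:
  assumes "i > 0"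
  shows "Suc i < m \<Longrightarrow> dd (Suc i) (ddown m g) = ddown m (dd i g)"
proof (induction m arbitrary: g)
  case (Suc m)
  show ?case
  proof (cases "m = Suc i")
    case True
    have "dd (Suc i) (ddown i (dd i (dd (Suc i) g))) = ddown i (dd (Suc i) (dd i (dd (Suc i) g)))"
      unfolding ddown_def by (intro dd_fold_dd') auto
    then show ?thesis
      using assms True by (simp add: ddown_Suc dd_braid)
  next
    case False
    with Suc have "Suc i < m" by simp
    with Suc.IH assms show ?thesis
      by (simp add: ddown_Suc dd_commute [of i m])
  qed
qed simp

lemma dd_1_ddown: "m > 0 \<Longrightarrow> dd 1 (ddown (Suc m) g) = 0"
  by (simp only: ddown_last dd_dd)

lemma flip_sym_zero [simp]: "flip_sym m 0 = 0"
  by (induction m) (auto simp: refl_act_def)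

lemma dd_flip_sym_far: "m < i \<Longrightarrow> dd i (flip_sym m f) = flip_sym m (dd i f)"
proof (induction m)
  case (Suc m)
  have "dd i (flip_sym (Suc m) f) = refl_act 0 (dd i (ddown (Suc m) (flip_sym m f)))"
    using Suc.prems by (simp add: refl_dd_far)
  also have "dd i (ddown (Suc m) (flip_sym m f)) = ddown (Suc m) (dd i (flip_sym m f))"
    unfolding ddown_def using Suc.prems by (intro dd_fold_dd') auto
  finally show ?case using Suc by simp
qed simp

text \<open>The sign change cancels the one ending \<open>flip_sym\<close>, leaving two successive
  runs, which compose to 0 by \<open>ddown_ddown_eq_0\<close>.\<close>

lemma ddown_refl_0_flip_sym:
  assumes "m > 0" "dd m f = 0"
  shows "ddown (Suc m) (refl_act 0 (flip_sym m f)) = 0"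
proof -
  obtain l where m: "m = Suc l" using assms by (cases m) auto
  have "ddown (Suc m) (ddown m (flip_sym l f)) = 0"
    using assms m by (intro ddown_ddown_eq_0) (auto simp: dd_flip_sym_far)
  then show ?thesis unfolding m refl_0_flip_sym .
qed

text \<open>Induction on \<open>m\<close>. Indices above 1 are lowered through the run by
  \<open>dd_Suc_ddown\<close>. For index 1 the run itself ends in \<open>dd 1\<close>, and after the
  sign change \<open>ddheart\<close> is needed.\<close>

lemma dd_flip_sym_eq_0:
  assumes "\<And>i. 0 < i \<Longrightarrow> i < m \<Longrightarrow> dd i f = 0" "0 < i" "i < m"
  shows "dd i (flip_sym m f) = 0 \<and> dd i (refl_act 0 (flip_sym m f)) = 0"
  using assms
proof (induction m arbitrary: i)
  case (Suc m)
  let ?g = "ddown (Suc m) (flip_sym m f)"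
  have m: "m > 0" using Suc.prems by simp
  have *: "dd i ?g = 0"
  proof (cases "i = 1")
    case True then show ?thesis using m dd_1_ddown by simp
  next
    case False
    then obtain j where "i = Suc j" "j > 0" using Suc.prems by (cases i) auto
    with Suc show ?thesis by (simp add: dd_Suc_ddown)
  qed
  have "dd i (refl_act 0 ?g) = 0"
  proof (cases "i = 1")
    case True
    let ?p = "fold dd (rev [2..<Suc m])"
    \<comment> \<open>Commuting \<open>ddheart\<close> with \<open>dd 1\<close> exposes the run
      applied to \<open>refl_act 0 (flip_sym m f)\<close>, which vanishes.\<close>
    have "refl_act 0 (dd 1 (refl_act 0 ?g)) = ddheart (dd 1 (?p (flip_sym m f)))"
      unfolding ddheart_eq using m by (simp only: ddown_last)
    also have "\<dots> = dd 1 (refl_act 0 (dd 1 (refl_act 0 (?p (flip_sym m f)))))"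
      unfolding ddheart_dd_1_commute by (simp only: ddheart_eq)
    also have "refl_act 0 (?p (flip_sym m f)) = ?p (refl_act 0 (flip_sym m f))"
      by (intro refl_fold_dd) auto
    also have "dd 1 \<dots> = 0"
      using m Suc.prems(1) by (simp only: ddown_last [symmetric] ddown_refl_0_flip_sym lessI)
    finally have "refl_act 0 (dd 1 (refl_act 0 ?g)) = 0"
      by (simp add: refl_act_def)
    then show ?thesis
      using True refl_invol [of 0 "dd 1 (refl_act 0 ?g)"] by (simp add: refl_act_def)
  next
    case False
    then show ?thesis
      using * Suc.prems refl_dd_far [of 0 i ?g] by (simp add: refl_act_def)
  qed
  with * show ?case by simp
qed simp

section \<open>Leibniz rule, and type B with as many factors as variables\<close>

lemma dd_xvar_Suc_mult: "i > 0 \<Longrightarrow> dd i (xvar (Suc i) * f) = xvar i * dd i f - f"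
proof (rule dd_eqI)
  assume i: "i > 0"
  then have r: "simple_root i = xvar i - xvar (Suc i)" by (cases i) auto
  have "(xvar i * dd i f - f) * simple_root i = xvar i * (dd i f * simple_root i) - f * simple_root i"
    by (simp add: algebra_simps)
  also have "\<dots> = xvar i * (f - refl_act i f) - f * (xvar i - xvar (Suc i))"
    by (simp only: dd_root) (simp only: r)
  also have "\<dots> = xvar (Suc i) * f - refl_act i (xvar (Suc i) * f)"
    using i by (simp add: refl_hom refl_xvar algebra_simps)
  finally show "(xvar i * dd i f - f) * simple_root i = xvar (Suc i) * f - refl_act i (xvar (Suc i) * f)" .
qed

text \<open>Since \<open>xvar 1\<close> is odd, the difference in the numerator becomes a sum; this
  is where both parities of \<open>flip_sym\<close> enter.\<close>

lemma dd_0_xvar_1_mult: "dd 0 (xvar 1 * f) = - (f + refl_act 0 f)"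
  by (rule dd_eqI) (simp add: refl_hom refl_xvar_0 algebra_simps)

lemma fold_dd_xvar_mult:
  assumes "0 < j" "j \<le> m" "\<And>i. 0 < i \<Longrightarrow> i < m \<Longrightarrow> dd i h = 0"
  shows "fold dd (rev [j..<Suc m]) (xvar (Suc m) * h) =
    xvar j * fold dd (rev [j..<Suc m]) h - fold dd (rev [Suc j..<Suc m]) h"
  using assms(2,1)
proof (induction j rule: inc_induct)
  case base
  then show ?case by (simp add: dd_xvar_Suc_mult)
next
  case (step j)
  \<comment> \<open>The earlier Leibniz correction dies: \<open>dd j\<close> passes the letters from
    \<open>j + 2\<close> on and kills \<open>h\<close>.\<close>
  have "dd j (fold dd (rev [Suc (Suc j)..<Suc m]) h) = fold dd (rev [Suc (Suc j)..<Suc m]) (dd j h)"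
    by (intro dd_fold_dd) auto
  also have "dd j h = 0" using step assms(3) by simp
  finally have "dd j (fold dd (rev [Suc (Suc j)..<Suc m]) h) = 0" by simp
  then have "dd j (a - fold dd (rev [Suc (Suc j)..<Suc m]) h) = dd j a" for a
    using dd_add [of j a "- fold dd (rev [Suc (Suc j)..<Suc m]) h"] by (simp add: dd_uminus)
  then show ?case
    using step by (simp add: rev_upt_Cons [of j] dd_xvar_Suc_mult del: upt_Suc)
qed

lemma dd_0_ddown_xvar_mult:
  assumes "m > 0" "\<And>i. 0 < i \<Longrightarrow> i < m \<Longrightarrow> dd i h = 0" "refl_act 0 h = h"
  shows "dd 0 (ddown (Suc m) (xvar (Suc m) * h)) = - (ddown (Suc m) h + refl_act 0 (ddown (Suc m) h))"
proof -
  let ?p = "fold dd (rev [2..<Suc m]) h"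
  have "ddown (Suc m) (xvar (Suc m) * h) = xvar 1 * ddown (Suc m) h - ?p"
    using fold_dd_xvar_mult [of 1 m h] assms by (simp add: ddown_def numeral_2_eq_2 del: upt_Suc)
  \<comment> \<open>The correction lacks the letter 1, so \<open>dd 0\<close> reaches the even
    \<open>h\<close> and kills it.\<close>
  moreover have "dd 0 ?p = fold dd (rev [2..<Suc m]) (dd 0 h)"
    by (intro dd_fold_dd) auto
  then have "dd 0 ?p = 0" using assms dd_eq_0_iff [of 0 h] by simp
  ultimately show ?thesis
    using dd_add [of 0 "xvar 1 * ddown (Suc m) h" "- ?p"]
    by (simp only: dd_uminus dd_0_xvar_1_mult) simp
qed

lemma nablaB_mult_invariant:
  assumes "\<And>i. i < n \<Longrightarrow> refl_act i g = g"
  shows "r \<le> n \<Longrightarrow> nablaB r n (g * f) = g * nablaB r n f"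
proof (induction r)
  case (Suc r)
  have "refl_act i g = g" if "i \<in> set [0..<Suc (n - Suc r)]" for i
    using that Suc.prems by (intro assms) auto
  with Suc show ?case
    by (simp only: nablaB_Suc ddrun_def fold_dd_mult_invariant Suc_leD)
qed simp

lemma refl_sign: "refl_act i ((- 1) ^ m) = (- 1) ^ m"
  by (simp add: refl_act_def psubst_power psubst_uminus)

text \<open>The run kills the second summand by \<open>ddown_refl_0_flip_sym\<close> and turns the
  first into the next \<open>flip_sym\<close> before its sign change.\<close>

lemma ddown_sign_flip_sym:
  assumes "m > 0" "dd m f = 0"
  shows "ddown (Suc m) ((- 1) ^ e * (flip_sym m f + refl_act 0 (flip_sym m f))) =
    (- 1) ^ e * refl_act 0 (flip_sym (Suc m) f)"
  using ddown_refl_0_flip_sym [OF assms]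
  by (simp add: ddown_def fold_dd_mult_invariant refl_sign fold_dd_add del: upt_Suc)

text \<open>Induction on \<open>m\<close>: the new variable is pulled out of the first
  \<open>m\<close> factors, and what remains is a descending run followed by
  \<open>dd 0\<close>.\<close>

lemma nablaB_diag:
  assumes "m > 0" "\<And>i. 0 < i \<Longrightarrow> i < m \<Longrightarrow> dd i f = 0"
  shows "nablaB m m (f * (\<Prod>i=1..m. xvar i)) =
    (- 1) ^ m * (flip_sym m f + refl_act 0 (flip_sym m f))"
  using assms
proof (induction m rule: nat_induct_non_zero)
  case 1
  have "nablaB 1 1 (f * xvar 1) = dd 0 (xvar 1 * f)"
    by (simp add: nablaB_Suc ddrun_def mult.commute)
  then show ?case
    using dd_0_xvar_1_mult by (simp add: add.commute)
next
  case (Suc m)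
  define h where "h = nablaB m m (f * (\<Prod>i=1..m. xvar i))"
  have h: "h = (- 1) ^ m * (flip_sym m f + refl_act 0 (flip_sym m f))"
    unfolding h_def using Suc by simp
  have sym: "dd i h = 0" if "0 < i" "i < m" for i
    unfolding h using that Suc.prems dd_flip_sym_eq_0 [of m f i]
    by (simp add: dd_mult_invariant refl_sign dd_add)
  have even: "refl_act 0 h = h"
    unfolding h by (simp add: refl_hom refl_sign add.commute)
  have R: "ddown (Suc m) h = (- 1) ^ m * refl_act 0 (flip_sym (Suc m) f)"
    unfolding h using Suc by (intro ddown_sign_flip_sym) auto
  have "nablaB m m (f * (\<Prod>i=1..Suc m. xvar i)) = nablaB m m (xvar (Suc m) * (f * (\<Prod>i=1..m. xvar i)))"
    by (simp add: ac_simps)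
  also have "\<dots> = xvar (Suc m) * h"
    unfolding h_def
  \<comment> \<open>Only letters below \<open>m\<close> occur, and these fix
    \<open>xvar (Suc m)\<close>.\<close>
  proof (rule nablaB_mult_invariant)
    show "refl_act i (xvar (Suc m)) = xvar (Suc m)" if "i < m" for i
      using that by (cases "i = 0") (auto simp: refl_xvar refl_xvar_0)
  qed simp
  finally have "nablaB (Suc m) (Suc m) (f * (\<Prod>i=1..Suc m. xvar i)) =
      dd 0 (ddown (Suc m) (xvar (Suc m) * h))"
    by (simp add: nablaB_Suc ddrun_def nablaB_Suc_diag)
  also have "\<dots> = - (ddown (Suc m) h + refl_act 0 (ddown (Suc m) h))"
    using sym even Suc.hyps by (intro dd_0_ddown_xvar_mult) auto
  also have "\<dots> = (- 1) ^ Suc m * (flip_sym (Suc m) f + refl_act 0 (flip_sym (Suc m) f))"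
    unfolding R by (simp only: refl_hom refl_sign refl_invol) (simp add: algebra_simps del: flip_sym.simps)
  finally show ?case .
qed

section \<open>Combining types B and D\<close>

lemma nablaD_diag_eq:
  assumes "k > 0" "\<And>i. 0 < i \<Longrightarrow> i < 2 * k \<Longrightarrow> dd i f = 0"
  shows "nablaD k (2 * k) f = nablaB (2 * k) (2 * k) (f * (\<Prod>i=1..2*k. xvar i)) +
    nablaB (2 * k - 1) (2 * k) (f * (\<Prod>i=1..2*k-1. xvar i))"
proof -
  \<comment> \<open>Since \<open>m = 2 * k - 1\<close> is odd, the second term has sign -1 and
    cancels the unwanted parity in the first.\<close>
  obtain m where m: "2 * k = Suc m" "odd m" "m > 0"
    using assms(1) by (cases k) auto
  have "nablaB m (Suc m) (f * (\<Prod>i=1..m. xvar i)) =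
      ddown (Suc m) ((- 1) ^ m * (flip_sym m f + refl_act 0 (flip_sym m f)))"
    unfolding nablaB_Suc_diag using assms(2) m by (subst nablaB_diag) auto
  also have "\<dots> = - refl_act 0 (flip_sym (Suc m) f)"
    using assms(2) m by (subst ddown_sign_flip_sym) auto
  finally have "nablaB (2 * k - 1) (2 * k) (f * (\<Prod>i=1..2*k-1. xvar i)) =
      - refl_act 0 (flip_sym (2 * k) f)"
    by (simp add: m)
  then show ?thesis
    using assms nablaB_diag [of "2 * k" f] by (simp add: nablaD_diag)
qed

lemma symmetric_dd_eq_0:
  assumes "symmetric_in {1..m} f" "0 < i" "i < m"
  shows "dd i f = 0"
proof -
  obtain j where i: "i = Suc j" using assms by (cases i) auto
  have "Transposition.transpose i (Suc i) permutes {1..m}"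
    using assms by (intro permutes_swap_id) auto
  then have "psubst (\<lambda>l. xvar (Transposition.transpose i (Suc i) l)) f = f"
    using assms unfolding symmetric_in_def by blast
  also have "(\<lambda>l. xvar (Transposition.transpose i (Suc i) l)) = rimg i"
    by (auto simp: i transpose_def fun_eq_iff)
  finally show ?thesis
    by (simp add: dd_eq_0_iff refl_act_def)
qed

theorem corollary8:
  fixes n k :: nat
  assumes "n > 0" and "k > 0" and "2 * k \<le> n"
  shows "\<forall>f \<in> Sym (2 * k) (n - 2 * k).
    nablaD k n f =
      nablaB (2 * k) n (f * (\<Prod>i=1..2*k. xvar i)) +
      ddrun 1 (n - 2 * k) (nablaB (2 * k - 1) n (f * (\<Prod>i=1..2*k-1. xvar i)))"
proof
  fix f assume "f \<in> Sym (2 * k) (n - 2 * k)"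
  then have f: "dd i f = 0" if "0 < i" "i < 2 * k" for i
    using that symmetric_dd_eq_0 by (auto simp: Sym_def)
  let ?G = "\<lambda>r. fold dd (grass_word (2 * k) r n)"
  \<comment> \<open>The last segment of the word is the run from 1 to \<open>n - 2 * k\<close>,
    exactly the trailing run of the second term.\<close>
  have G: "?G (2 * k) g = ddrun 1 (n - 2 * k) (?G (2 * k - 1) g)" for g
    using grass_word_Suc [of "2 * k" "2 * k - 1" n] assms by (simp add: ddrun_def del: upt_Suc)
  have "nablaD k n f = ?G (2 * k) (nablaD k (2 * k) f)"
    using assms by (intro nablaD_split) auto
  also have "\<dots> = ?G (2 * k) (nablaB (2 * k) (2 * k) (f * (\<Prod>i=1..2*k. xvar i))) +
      ?G (2 * k) (nablaB (2 * k - 1) (2 * k) (f * (\<Prod>i=1..2*k-1. xvar i)))"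
    using assms f by (simp add: nablaD_diag_eq fold_dd_add)
  also have "?G (2 * k) (nablaB (2 * k) (2 * k) (f * (\<Prod>i=1..2*k. xvar i))) =
      nablaB (2 * k) n (f * (\<Prod>i=1..2*k. xvar i))"
    using assms by (intro nablaB_split [symmetric]) auto
  also have "?G (2 * k) (nablaB (2 * k - 1) (2 * k) (f * (\<Prod>i=1..2*k-1. xvar i))) =
      ddrun 1 (n - 2 * k) (nablaB (2 * k - 1) n (f * (\<Prod>i=1..2*k-1. xvar i)))"
    unfolding G using assms by (subst nablaB_split [of "2 * k - 1" "2 * k" n]) auto
  finally show "nablaD k n f = nablaB (2 * k) n (f * (\<Prod>i=1..2*k. xvar i)) +
      ddrun 1 (n - 2 * k) (nablaB (2 * k - 1) n (f * (\<Prod>i=1..2*k-1. xvar i)))" .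
qed

end
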